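(* Let $m=2$, let $n=2p$, fix $X\in\mathcal X^n$ and $V>0$. Among all designs $\sigma\in\Delta$, complete randomization minimizes $$\max_{Y\in\mathbb R^{n\times m}:\ \mathrm{var}(\hat\tau^{\mathrm{CR}}\mid X,Y)=V}\ \mathrm{var}(\hat\tau\mid X,Y).$$ More generally, for any row-permutationally invariant seminorm $\|\cdot\|$ on $\mathbb R^{n\times m}$ (i.e. $\|PY\|=\|Y\|$ for all $n\times n$ permutation matrices $P$ and all $Y\in\mathbb R^{n\times m}$), complete randomization minimizes, among all designs $\sigma\in\Delta$, $$\max_{Y\in\mathbb R^{n\times m}:\ \|Y\|\le V}\ \mathrm{var}(\hat\tau\mid X,Y).$$ In particular, if a design fixes a partition of the units into two groups of size $p$ and only flips a (fair) coin for blinding treatments (i.e. it puts probability $1/2$ on each of the two assignments that give one group treatment 1 and the other group treatment 2), then $$\max_{Y\in\mathbb R^{n\times m}:\ \mathrm{var}(\hat\tau^{\mathrm{CR}}\mid X,Y)=V}\ \mathrm{var}(\hat\tau\mid X,Y)=V(n-1).$$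
   Context: There are $n=2p$ subjects with fixed baseline covariates $X=(X_1,\dots,X_n)\in\mathcal X^n$ ($\mathcal X$ an arbitrary set) and $m=2$ treatments. $Y=(Y_{ik})\in\mathbb R^{n\times 2}$ is the matrix of potential outcomes ($Y_{ik}$ is the outcome of subject $i$ under treatment $k$). An assignment is $W\in\{1,2\}^n$; $\mathcal W$ is the set of assignments with exactly $p$ subjects in each treatment. For fixed $X$, a design is a probability distribution $\sigma$ on assignments. $\Delta$ denotes the set of designs satisfying the paper's Assumption 1, i.e. distributions $\sigma$ that (a) do not depend on $Y$ ($W$ is independent of $Y$ given $X$), (b) blind treatments: $\sigma((k_1,\dots,k_n))=\sigma((\pi(k_1),\dots,\pi(k_n)))$ for every permutation $\pi$ of $\{1,2\}$, and (c) are supported on $\mathcal W$. Complete randomization is the uniform distribution on $\mathcal W$. The estimator is $\hat\tau=\frac1p\sum_{i:W_i=1}Y_{i1}-\frac1p\sum_{i:W_i=2}Y_{i2}$, and $\mathrm{var}(\hat\tau\mid X,Y)$ is its variance over $W\sim\sigma$ with $X,Y$ fixed. $\hat\tau^{\mathrm{CR}}$ is the same estimator when $W$ is drawn from complete randomization. Maxima are understood as suprema in $[0,\infty]$. *)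

theory Defs
  imports "HOL-Probability.Probability"
begin

text \<open>
  Subjects are the elements of a finite type \<open>'n\<close>; treatments are the elements \<open>1\<close> and
  \<open>2\<close> of the two-element type \<open>2\<close> (in which the numeral \<open>2\<close> is \<open>0\<close>, and differs from \<open>1\<close>).
  An outcome matrix \<open>Y :: real^2^'n\<close> has entries \<open>Y $ i $ k\<close>, with rows indexed by subjects.

  A design is given as the conditional law of the assignment given covariates and potential
  outcomes, so that independence of \<open>W\<close> and \<open>Y\<close> given \<open>X\<close> is an explicit condition. For fixed
  \<open>X\<close> and under this condition it is just one probability distribution on assignments.
\<close>

type_synonym 'n assignment = "'n \<Rightarrow> 2"

type_synonym ('x, 'n) design = "('n \<Rightarrow> 'x) \<Rightarrow> real^2^'n \<Rightarrow> 'n assignment pmf"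

definition balanced :: "nat \<Rightarrow> ('n::finite) assignment set" where
  "balanced p = {W. \<forall>k. card {i. W i = k} = p}"

definition designs :: "nat \<Rightarrow> ('n \<Rightarrow> 'x) \<Rightarrow> ('x, 'n::finite) design set" where
  "designs p X = {\<sigma>.
     (\<forall>Y Y'. \<sigma> X Y = \<sigma> X Y') \<and>
     (\<forall>Y \<pi> W. \<pi> permutes UNIV \<longrightarrow> pmf (\<sigma> X Y) W = pmf (\<sigma> X Y) (\<pi> \<circ> W)) \<and>
     (\<forall>Y. set_pmf (\<sigma> X Y) \<subseteq> balanced p)}"

definition complete_randomization :: "nat \<Rightarrow> ('x, 'n::finite) design" where
  "complete_randomization p = (\<lambda>X Y. pmf_of_set (balanced p))"

definition tau_hat :: "nat \<Rightarrow> real^2^'n \<Rightarrow> ('n::finite) assignment \<Rightarrow> real" where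
  "tau_hat p Y W =
     1 / real p * (\<Sum>i | W i = 1. Y $ i $ 1) - 1 / real p * (\<Sum>i | W i = 2. Y $ i $ 2)"

definition var_tau :: "nat \<Rightarrow> ('x, 'n::finite) design \<Rightarrow> ('n \<Rightarrow> 'x) \<Rightarrow> real^2^'n \<Rightarrow> real" where
  "var_tau p \<sigma> X Y = measure_pmf.variance (\<sigma> X Y) (tau_hat p Y)"

definition seminorm :: "('a::real_vector \<Rightarrow> real) \<Rightarrow> bool" where
  "seminorm N \<longleftrightarrow>
     (\<forall>x. 0 \<le> N x) \<and> (\<forall>c x. N (c *\<^sub>R x) = \<bar>c\<bar> * N x) \<and> (\<forall>x y. N (x + y) \<le> N x + N y)"

definition permutation_matrix :: "real^'n^'n \<Rightarrow> bool" where
  "permutation_matrix P \<longleftrightarrow>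
     (\<exists>\<pi>. \<pi> permutes UNIV \<and> P = (\<chi> i j. if j = \<pi> i then 1 else 0))"

definition row_permutation_invariant :: "(real^2^'n \<Rightarrow> real) \<Rightarrow> bool" where
  "row_permutation_invariant N \<longleftrightarrow> (\<forall>P Y. permutation_matrix P \<longrightarrow> N (P ** Y) = N Y)"

definition group_assignment :: "'n set \<Rightarrow> 'n assignment" where
  "group_assignment G = (\<lambda>i. if i \<in> G then 1 else 2)"

text \<open>The groups \<open>G\<close> and \<open>- G\<close> are fixed; only their treatment labels are randomized.\<close>

definition fixed_partition_design :: "('n \<Rightarrow> 'x) \<Rightarrow> 'n set \<Rightarrow> ('x, 'n::finite) design \<Rightarrow> bool" where
  "fixed_partition_design X G \<sigma> \<longleftrightarrow>
     (\<forall>Y. pmf (\<sigma> X Y) (group_assignment G) = 1 / 2 \<and>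
          pmf (\<sigma> X Y) (group_assignment (- G)) = 1 / 2)"

end

theory Submission
  imports Defs
begin

text \<open>
  Complete randomization is the average of any admissible design over all relabellings of the
  subjects, and a maximum over a set that is closed under relabelling is at least the average
  over relabellings.

  In detail, the estimator is a constant plus a multiple of the signed sum
  \<open>contrast z W = (\<Sum>i. \<plusminus> z\<^sub>i)\<close>, where the sign of \<open>i\<close> records its treatment and
  \<open>z\<^sub>i = Y\<^sub>i\<^sub>1 + Y\<^sub>i\<^sub>2\<close>. Blinding makes the mean of the signed sum vanish, so the variance is
  linear in the design: it is the expectation of \<open>(contrast z W)\<^sup>2 / (4 p\<^sup>2)\<close>. Permuting the
  rows of \<open>Y\<close> has the same effect on the signed sum as permuting the subjects in \<open>W\<close>, and a
  uniformly random permutation turns every balanced assignment into a uniformly random balanced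
  one. Hence the mean of \<open>var_tau p \<sigma> X (P Y)\<close> over the row permutations \<open>P\<close> is the variance
  of \<open>Y\<close> under complete randomization (\<open>average_var_tau_permute_rows\<close>), some \<open>P Y\<close> is at least
  as bad for \<open>\<sigma>\<close> as \<open>Y\<close> is for complete randomization, and optimality follows for every set of
  outcome matrices closed under row permutations (\<open>complete_randomization_minimax\<close>). Both a ball
  of an invariant seminorm and a level set of the variance under complete randomization are such
  sets.

  For a fixed partition the variance is the single square \<open>(contrast z W)\<^sup>2 / (4 p\<^sup>2)\<close>. By
  Cauchy--Schwarz, \<open>(contrast z W)\<^sup>2\<close> is at most \<open>n (\<Sum>z\<^sub>i\<^sup>2) - (\<Sum>z\<^sub>i)\<^sup>2\<close>, with equality
  when \<open>z\<close> is a multiple of the sign vector of the partition. Under complete randomization the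
  signs have pairwise covariance \<open>- 1 / (n - 1)\<close>, which makes the second moment of the contrast
  exactly \<open>n - 1\<close> times smaller than this bound.
\<close>

section \<open>The estimator as a signed sum\<close>

definition treatment_sign :: "2 \<Rightarrow> real" where
  "treatment_sign k = (if k = 1 then 1 else -1)"

definition contrast :: "('n::finite \<Rightarrow> real) \<Rightarrow> 'n assignment \<Rightarrow> real" where
  "contrast z W = (\<Sum>i\<in>UNIV. treatment_sign (W i) * z i)"

definition outcome_sum :: "real^2^'n \<Rightarrow> 'n \<Rightarrow> real" where
  "outcome_sum Y i = Y $ i $ 1 + Y $ i $ 2"

definition average_effect :: "nat \<Rightarrow> real^2^('n::finite) \<Rightarrow> real" where
  "average_effect p Y = (\<Sum>i\<in>UNIV. Y $ i $ 1 - Y $ i $ 2) / (2 * real p)"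

lemma treatment_sign_simps [simp]:
  "treatment_sign 1 = 1" "treatment_sign 2 = -1"
  by (simp_all add: treatment_sign_def)

lemma treatment_sign_square [simp]: "treatment_sign k * treatment_sign k = 1"
  by (simp add: treatment_sign_def)

lemma contrast_eq_diff:
  "contrast z W = (\<Sum>i | W i = 1. z i) - (\<Sum>i | W i = 2. z i)"
proof -
  have "contrast z W = (\<Sum>i\<in>UNIV. (if W i = 1 then z i else 0) - (if W i = 2 then z i else 0))"
    unfolding contrast_def
  proof (rule sum.cong)
    fix i
    show "treatment_sign (W i) * z i = (if W i = 1 then z i else 0) - (if W i = 2 then z i else 0)"
      using exhaust_2[of "W i"] by (auto simp: treatment_sign_def)
  qed simp
  also have "\<dots> = (\<Sum>i | W i = 1. z i) - (\<Sum>i | W i = 2. z i)"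
    by (simp add: sum_subtractf sum.If_cases)
  finally show ?thesis .
qed

lemma sum_eq_sum_over_groups:
  fixes z :: "'n::finite \<Rightarrow> real"
  shows "sum z UNIV = (\<Sum>i | W i = (1::2). z i) + (\<Sum>i | W i = 2. z i)"
proof -
  have "UNIV = {i. W i = 1} \<union> {i. W i = 2}" using exhaust_2 by auto
  moreover have "sum z ({i. W i = 1} \<union> {i. W i = 2}) = (\<Sum>i | W i = 1. z i) + (\<Sum>i | W i = 2. z i)"
    by (rule sum.union_disjoint) auto
  ultimately show ?thesis by simp
qed

text \<open>
  Treatment indicators are \<open>(1 \<plusminus> sign) / 2\<close>; the constant halves collect the differences
  \<open>Y\<^sub>i\<^sub>1 - Y\<^sub>i\<^sub>2\<close>, and the signed halves collect the sums \<open>Y\<^sub>i\<^sub>1 + Y\<^sub>i\<^sub>2\<close>.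
\<close>

lemma tau_hat_eq:
  assumes "p > 0"
  shows "tau_hat p Y W = average_effect p Y + contrast (outcome_sum Y) W / (2 * real p)"
proof -
  have a: "(\<Sum>i\<in>UNIV. Y $ i $ 1 - Y $ i $ 2)
      = (\<Sum>i | W i = 1. Y $ i $ 1 - Y $ i $ 2) + (\<Sum>i | W i = 2. Y $ i $ 1 - Y $ i $ 2)"
    by (rule sum_eq_sum_over_groups)
  show ?thesis
    unfolding tau_hat_def average_effect_def contrast_eq_diff a outcome_sum_def
    using assms by (simp add: sum.distrib sum_subtractf field_simps)
qed

lemma var_tau_eq:
  fixes \<sigma> :: "('x, 'n::finite) design"
  assumes "p > 0"
    and "measure_pmf.expectation (\<sigma> X Y) (contrast (outcome_sum Y)) = 0"
  shows "var_tau p \<sigma> X Y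
    = measure_pmf.expectation (\<sigma> X Y) (\<lambda>W. (contrast (outcome_sum Y) W)\<^sup>2) / (4 * (real p)\<^sup>2)"
proof -
  have fin: "integrable (measure_pmf (\<sigma> X Y)) g" for g :: "'n assignment \<Rightarrow> real"
    by (rule integrable_measure_pmf_finite) simp
  have "measure_pmf.expectation (\<sigma> X Y) (tau_hat p Y) = average_effect p Y"
    unfolding tau_hat_eq[OF assms(1), abs_def] using assms(2) fin by simp
  then show ?thesis
    unfolding var_tau_def tau_hat_eq[OF assms(1), abs_def]
    using assms(1) by (simp add: power_divide power_mult_distrib)
qed

section \<open>Blinding and balance\<close>

lemma swap_treatments_sign:
  "treatment_sign (Transposition.transpose 1 2 k) = - treatment_sign k"
  using exhaust_2[of k] by (auto simp: treatment_sign_def)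

lemma contrast_swap: "contrast z (Transposition.transpose 1 2 \<circ> W) = - contrast z W"
  by (simp add: contrast_def swap_treatments_sign sum_negf)

text \<open>
  Exchanging the two treatments preserves the law of the assignment and negates the contrast.
\<close>

lemma expectation_contrast_blinded:
  fixes M :: "('n::finite) assignment pmf"
  assumes blind: "\<And>\<pi> W. \<pi> permutes UNIV \<Longrightarrow> pmf M W = pmf M (\<pi> \<circ> W)"
  shows "measure_pmf.expectation M (contrast z) = 0"
proof -
  define s :: "2 \<Rightarrow> 2" where "s = Transposition.transpose 1 2"
  have s: "s permutes UNIV" unfolding s_def by (rule permutes_swap_id) auto
  have ss: "s \<circ> (s \<circ> W) = W" for W :: "'n assignment" by (simp add: s_def fun_eq_iff)
  have E: "measure_pmf.expectation M (contrast z) = (\<Sum>W\<in>UNIV. contrast z W * pmf M W)"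
    by (rule integral_measure_pmf_real) auto
  also have "\<dots> = (\<Sum>W\<in>UNIV. contrast z (s \<circ> W) * pmf M (s \<circ> W))"
    by (rule sum.reindex_bij_witness[of _ "\<lambda>W. s \<circ> W" "\<lambda>W. s \<circ> W"])
      (simp_all add: ss)
  also have "\<dots> = - (\<Sum>W\<in>UNIV. contrast z W * pmf M W)"
    unfolding blind[OF s, symmetric] by (simp add: s_def contrast_swap sum_negf)
  finally show ?thesis using E by simp
qed

lemma half_size_pos:
  assumes "CARD('n::finite) = 2 * p"
  shows "p > 0"
  using assms zero_less_card_finite[where 'a = 'n] by simp

lemma group_assignment_balanced:
  fixes G :: "'n::finite set"
  assumes "CARD('n) = 2 * p" "card G = p"
  shows "group_assignment G \<in> balanced p"
proof -
  have "card (- G) = p" using assms by (simp add: Compl_eq_Diff_UNIV card_Diff_subset)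
  moreover have "{i. group_assignment G i = 1} = G" "{i. group_assignment G i = 2} = - G"
    by (auto simp: group_assignment_def)
  ultimately show ?thesis using assms by (simp add: balanced_def forall_2)
qed

lemma balanced_nonempty:
  assumes "CARD('n::finite) = 2 * p"
  shows "(balanced p :: 'n assignment set) \<noteq> {}"
proof -
  obtain G :: "'n set" where "card G = p"
    using obtain_subset_with_card_n[of p "UNIV :: 'n set"] assms by auto
  then show ?thesis using group_assignment_balanced[OF assms] by blast
qed

lemma balanced_relabel:
  assumes "\<pi> permutes (UNIV :: 2 set)"
  shows "\<pi> \<circ> W \<in> balanced p \<longleftrightarrow> W \<in> balanced p"
proof -
  have "{i. (\<pi> \<circ> W) i = k} = {i. W i = inv \<pi> k}" for k
    using permutes_inverses[OF assms] by auto
  moreover have "(\<forall>k. card {i. W i = inv \<pi> k} = p) \<longleftrightarrow> (\<forall>k. card {i. W i = k} = p)"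
    using permutes_inverses[OF assms] by metis
  ultimately show ?thesis by (simp add: balanced_def)
qed

lemma balanced_permute_subjects:
  assumes "\<pi> permutes (UNIV :: 'n::finite set)"
  shows "W \<circ> \<pi> \<in> balanced p \<longleftrightarrow> W \<in> balanced p"
proof -
  have "card {i. (W \<circ> \<pi>) i = k} = card {i. W i = k}" for k
    using card_vimage_inj[of \<pi> "{i. W i = k}"] assms
    by (simp add: permutes_inj permutes_surj vimage_def)
  then show ?thesis by (simp add: balanced_def)
qed

text \<open>
  The subjects act transitively on balanced assignments, since two labellings with the same
  number of subjects at each label differ by a permutation of the subjects.
\<close>

lemma balanced_obtain_permutation:
  assumes "W \<in> balanced p" "W' \<in> balanced p"
  obtains \<rho> where "\<rho> permutes (UNIV :: 'n::finite set)" "W = W' \<circ> \<rho>"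
proof -
  have c: "count (image_mset f (mset_set UNIV)) k = card {i. f i = k}"
    for f :: "'n assignment" and k
    by (simp add: count_image_mset' vimage_def eq_commute)
  have "image_mset W (mset_set UNIV) = image_mset W' (mset_set UNIV)"
    using assms by (intro multiset_eqI) (simp add: c balanced_def)
  from image_mset_eq_implies_permutes[OF _ this] that show ?thesis
    by (auto simp: fun_eq_iff)
qed

section \<open>Complete randomization as the symmetrization of any design\<close>

lemma complete_randomization_in_designs:
  assumes "CARD('n::finite) = 2 * p"
  shows "(complete_randomization p :: ('x, 'n) design) \<in> designs p X"
  using balanced_nonempty[OF assms]
  by (auto simp: designs_def complete_randomization_def set_pmf_of_set pmf_of_set balanced_relabel
      indicator_def)

lemma expectation_complete_randomization:
  fixes f :: "('n::finite) assignment \<Rightarrow> real"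
  assumes "CARD('n) = 2 * p"
  shows "measure_pmf.expectation (complete_randomization p X Y) f
    = (\<Sum>W\<in>balanced p. f W) / card (balanced p :: 'n assignment set)"
  unfolding complete_randomization_def
  by (rule integral_pmf_of_set) (use balanced_nonempty[OF assms] in auto)

lemma sum_balanced_permute:
  assumes "\<pi> permutes (UNIV :: 'n::finite set)"
  shows "(\<Sum>W\<in>balanced p. f (W \<circ> \<pi>)) = (\<Sum>W\<in>balanced p. f W)"
  by (rule sum.reindex_bij_witness[of _ "\<lambda>W. W \<circ> inv \<pi>" "\<lambda>W. W \<circ> \<pi>"])
    (auto simp: balanced_permute_subjects assms permutes_inv comp_assoc permutes_inv_o[OF assms])

text \<open>
  A uniformly random permutation of the subjects makes a balanced assignment uniform on
  \<open>balanced p\<close>. By transitivity the sum over permutations does not depend on the balanced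
  assignment it starts from; averaging it over all of them and exchanging the two sums avoids
  counting stabilizers.
\<close>

lemma sum_permutations_balanced:
  fixes f :: "('n::finite) assignment \<Rightarrow> real"
  assumes "W \<in> balanced p"
  shows "(\<Sum>\<pi> | \<pi> permutes UNIV. f (W \<circ> inv \<pi>))
    = card {\<pi>. \<pi> permutes (UNIV :: 'n set)} * ((\<Sum>W\<in>balanced p. f W) / card (balanced p :: 'n assignment set))"
proof -
  let ?S = "{\<pi>. \<pi> permutes (UNIV :: 'n set)}"
  let ?B = "balanced p :: 'n assignment set"
  have *: "(\<Sum>\<pi>\<in>?S. f (W' \<circ> inv \<pi>)) = (\<Sum>\<pi>\<in>?S. f (W \<circ> inv \<pi>))" if W': "W' \<in> ?B" for W'
  proof -
    obtain \<rho> where \<rho>: "\<rho> permutes UNIV" "W' = W \<circ> \<rho>"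
      using balanced_obtain_permutation[OF W' assms] by blast
    have "(\<Sum>\<pi>\<in>?S. f (W' \<circ> inv \<pi>)) = (\<Sum>\<pi>\<in>?S. f (W' \<circ> \<pi>))"
      by (rule sum_permutations_inverse[symmetric])
    also have "\<dots> = (\<Sum>\<pi>\<in>?S. f (W \<circ> (\<rho> \<circ> \<pi>)))" by (simp add: \<rho> comp_assoc)
    also have "\<dots> = (\<Sum>\<pi>\<in>?S. f (W \<circ> \<pi>))"
      by (rule setum_permutations_compose_left[OF \<rho>(1), symmetric])
    also have "\<dots> = (\<Sum>\<pi>\<in>?S. f (W \<circ> inv \<pi>))" by (rule sum_permutations_inverse)
    finally show ?thesis .
  qed
  have "card ?B * (\<Sum>\<pi>\<in>?S. f (W \<circ> inv \<pi>)) = (\<Sum>W'\<in>?B. \<Sum>\<pi>\<in>?S. f (W' \<circ> inv \<pi>))"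
    using * by simp
  also have "\<dots> = (\<Sum>\<pi>\<in>?S. \<Sum>W'\<in>?B. f (W' \<circ> inv \<pi>))" by (rule sum.swap)
  also have "\<dots> = card ?S * (\<Sum>W\<in>?B. f W)"
    by (simp add: sum_balanced_permute permutes_inv)
  finally have "card ?B * (\<Sum>\<pi>\<in>?S. f (W \<circ> inv \<pi>)) = card ?S * (\<Sum>W\<in>?B. f W)" .
  moreover have "card ?B \<noteq> 0" using assms by auto
  ultimately show ?thesis by (simp add: field_simps)
qed

definition permute_rows :: "('n \<Rightarrow> 'n) \<Rightarrow> real^2^'n \<Rightarrow> real^2^('n::finite)" where
  "permute_rows \<pi> Y = (\<chi> i. Y $ \<pi> i)"

lemma contrast_permute_rows:
  assumes "\<pi> permutes UNIV"
  shows "contrast (outcome_sum (permute_rows \<pi> Y)) W = contrast (outcome_sum Y) (W \<circ> inv \<pi>)"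
  unfolding contrast_def
  by (rule sum.reindex_bij_witness[of _ "inv \<pi>" \<pi>])
    (auto simp: permute_rows_def outcome_sum_def permutes_inverses[OF assms])

lemma seminorm_permute_rows:
  fixes N :: "real^2^('n::finite) \<Rightarrow> real"
  assumes "row_permutation_invariant N" "\<pi> permutes UNIV"
  shows "N (permute_rows \<pi> Y) = N Y"
proof -
  let ?P = "(\<chi> i j. if j = \<pi> i then 1 else 0) :: real^'n^'n"
  have "?P ** Y = permute_rows \<pi> Y"
    by (simp add: vec_eq_iff matrix_matrix_mult_def permute_rows_def if_distrib[of "\<lambda>x. x * _"]
        cong: if_cong)
  moreover have "permutation_matrix ?P" using assms(2) by (auto simp: permutation_matrix_def)
  then have "N (?P ** Y) = N Y" using assms(1) by (simp add: row_permutation_invariant_def)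
  ultimately show ?thesis by simp
qed

lemma var_tau_design:
  fixes \<sigma> :: "('x, 'n::finite) design"
  assumes "p > 0" "\<sigma> \<in> designs p X"
  shows "var_tau p \<sigma> X Y
    = measure_pmf.expectation (\<sigma> X Y) (\<lambda>W. (contrast (outcome_sum Y) W)\<^sup>2) / (4 * (real p)\<^sup>2)"
proof (rule var_tau_eq[OF assms(1)])
  show "measure_pmf.expectation (\<sigma> X Y) (contrast (outcome_sum Y)) = 0"
    using assms(2) unfolding designs_def by (intro expectation_contrast_blinded) blast
qed

lemma var_tau_complete_randomization_permute_rows:
  fixes X :: "'n::finite \<Rightarrow> 'x"
  assumes n: "CARD('n) = 2 * p" and \<pi>: "\<pi> permutes UNIV"
  shows "var_tau p (complete_randomization p) X (permute_rows \<pi> Y)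
    = var_tau p (complete_randomization p) X Y"
proof -
  have p: "p > 0" by (rule half_size_pos[OF n])
  show ?thesis
    unfolding var_tau_design[OF p complete_randomization_in_designs[OF n]]
      expectation_complete_randomization[OF n] contrast_permute_rows[OF \<pi>]
      sum_balanced_permute[OF permutes_inv[OF \<pi>], of "\<lambda>W. (contrast (outcome_sum Y) W)\<^sup>2" p]
    by (rule refl)
qed

text \<open>
  The variance is an expectation of one fixed function of the contrast, so the average over row
  permutations can be taken inside the expectation. There, for each assignment in the support of
  \<open>\<sigma>\<close>, it is the expectation under complete randomization.
\<close>

lemma average_var_tau_permute_rows:
  fixes X :: "'n::finite \<Rightarrow> 'x"
  assumes n: "CARD('n) = 2 * p" and \<sigma>: "\<sigma> \<in> designs p X"
  shows "(\<Sum>\<pi> | \<pi> permutes UNIV. var_tau p \<sigma> X (permute_rows \<pi> Y))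
    = card {\<pi>. \<pi> permutes (UNIV :: 'n set)} * var_tau p (complete_randomization p) X Y"
proof -
  let ?S = "{\<pi>. \<pi> permutes (UNIV :: 'n set)}"
  let ?f = "\<lambda>W. (contrast (outcome_sum Y) W)\<^sup>2"
  let ?E = "measure_pmf.expectation (\<sigma> X Y)"
  let ?e = "measure_pmf.expectation (complete_randomization p X Y) ?f"
  have p: "p > 0" by (rule half_size_pos[OF n])
  \<comment> \<open>Permuting the rows of \<open>Y\<close> must leave the law of \<open>W\<close> alone for the average to move inside.\<close>
  have indep: "\<sigma> X Y' = \<sigma> X Y" for Y' using \<sigma> unfolding designs_def by blast
  have supp: "W \<in> balanced p" if "W \<in> set_pmf (\<sigma> X Y)" for W
    using \<sigma> that unfolding designs_def by blast
  have pointwise: "(\<Sum>\<pi>\<in>?S. ?f (W \<circ> inv \<pi>)) = card ?S * ?e" if "W \<in> set_pmf (\<sigma> X Y)" for W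
    using sum_permutations_balanced[OF supp[OF that], of ?f]
    by (simp only: expectation_complete_randomization[OF n])
  have "(\<Sum>\<pi>\<in>?S. ?E (\<lambda>W. ?f (W \<circ> inv \<pi>))) = ?E (\<lambda>W. \<Sum>\<pi>\<in>?S. ?f (W \<circ> inv \<pi>))"
    by (rule Bochner_Integration.integral_sum[symmetric]) (rule integrable_measure_pmf_finite, simp)
  also have "\<dots> = ?E (\<lambda>W. card ?S * ?e)"
    by (rule integral_cong_AE) (simp_all add: AE_measure_pmf_iff pointwise)
  finally have sum: "(\<Sum>\<pi>\<in>?S. ?E (\<lambda>W. ?f (W \<circ> inv \<pi>))) = card ?S * ?e"
    by simp
  have "(\<Sum>\<pi>\<in>?S. var_tau p \<sigma> X (permute_rows \<pi> Y))
      = (\<Sum>\<pi>\<in>?S. ?E (\<lambda>W. ?f (W \<circ> inv \<pi>)) / (4 * (real p)\<^sup>2))"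
    by (intro sum.cong refl)
      (simp only: var_tau_design[OF p \<sigma>] contrast_permute_rows mem_Collect_eq
        indep[of "permute_rows _ Y"])
  also have "\<dots> = card ?S * ?e / (4 * (real p)\<^sup>2)"
    by (simp add: sum_divide_distrib[symmetric] sum)
  finally show ?thesis
    by (simp add: var_tau_design[OF p complete_randomization_in_designs[OF n]])
qed

text \<open>
  At least one term of an average is no smaller than the average. The permutation plays the role
  of an adversary that adapts the outcomes to the design.
\<close>

lemma exists_unfavourable_permutation:
  fixes X :: "'n::finite \<Rightarrow> 'x"
  assumes n: "CARD('n) = 2 * p" and \<sigma>: "\<sigma> \<in> designs p X"
  obtains \<pi> where "\<pi> permutes UNIV"
    "var_tau p (complete_randomization p) X Y \<le> var_tau p \<sigma> X (permute_rows \<pi> Y)"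
proof (rule ccontr)
  let ?S = "{\<pi>. \<pi> permutes (UNIV :: 'n set)}"
  assume "\<not> thesis"
  then have "\<forall>\<pi>\<in>?S. var_tau p \<sigma> X (permute_rows \<pi> Y)
      < var_tau p (complete_randomization p) X Y"
    using that by (meson mem_Collect_eq not_le)
  then have "(\<Sum>\<pi>\<in>?S. var_tau p \<sigma> X (permute_rows \<pi> Y))
      < (\<Sum>\<pi>\<in>?S. var_tau p (complete_randomization p) X Y)"
    using permutes_id by (intro sum_strict_mono) (auto simp: finite_permutations intro: exI[of _ id])
  then show False by (simp add: average_var_tau_permute_rows[OF n \<sigma>])
qed

text \<open>
  As \<open>S\<close> is closed under row permutations, the unfavourable permutation of an outcome matrix in
  \<open>S\<close> competes in the same supremum. This is the common core of the two optimality claims, where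
  \<open>S\<close> is a level set of the variance under complete randomization or a ball of a seminorm.
\<close>

lemma complete_randomization_minimax:
  fixes X :: "'n::finite \<Rightarrow> 'x"
  assumes n: "CARD('n) = 2 * p"
    and inv: "\<And>\<pi> Y. \<pi> permutes UNIV \<Longrightarrow> Y \<in> S \<Longrightarrow> permute_rows \<pi> Y \<in> S"
  shows "is_arg_min
     (\<lambda>\<sigma> :: ('x, 'n) design. SUP Y\<in>S. ennreal (var_tau p \<sigma> X Y))
     (\<lambda>\<sigma>. \<sigma> \<in> designs p X) (complete_randomization p)"
proof -
  have "(SUP Y\<in>S. ennreal (var_tau p (complete_randomization p) X Y))
      \<le> (SUP Y\<in>S. ennreal (var_tau p \<sigma> X Y))" if \<sigma>: "\<sigma> \<in> designs p X" for \<sigma>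
  proof (rule SUP_least)
    fix Y assume "Y \<in> S"
    obtain \<pi> where \<pi>: "\<pi> permutes UNIV"
      "var_tau p (complete_randomization p) X Y \<le> var_tau p \<sigma> X (permute_rows \<pi> Y)"
      using exists_unfavourable_permutation[OF n \<sigma>] by blast
    show "ennreal (var_tau p (complete_randomization p) X Y) \<le> (SUP Y\<in>S. ennreal (var_tau p \<sigma> X Y))"
      by (rule SUP_upper2[OF inv[OF \<pi>(1) \<open>Y \<in> S\<close>]]) (rule ennreal_leI[OF \<pi>(2)])
  qed
  then show ?thesis
    using complete_randomization_in_designs[OF n] by (auto simp: is_arg_min_def not_less)
qed

section \<open>The worst case of a fixed partition\<close>

lemma sum_treatment_sign_balanced:
  "W \<in> balanced p \<Longrightarrow> (\<Sum>i\<in>UNIV. treatment_sign (W i)) = 0"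
  using contrast_eq_diff[of "\<lambda>_. 1" W] by (simp add: contrast_def balanced_def)

text \<open>
  The signs of a balanced assignment sum to zero, so the second moments of the sign of \<open>i\<close> with
  all signs sum to zero. The one with itself is \<open>1\<close>, and the other \<open>n - 1\<close> are equal by symmetry.
\<close>

lemma sign_covariance_complete_randomization:
  fixes i j :: "'n::finite"
  assumes n: "CARD('n) = 2 * p" and "i \<noteq> j"
  shows "measure_pmf.expectation (complete_randomization p X Y)
      (\<lambda>W. treatment_sign (W i) * treatment_sign (W j)) = - 1 / (real CARD('n) - 1)"
proof -
  let ?E = "measure_pmf.expectation (complete_randomization p X Y) :: ('n assignment \<Rightarrow> real) \<Rightarrow> real"
  define C where "C k = ?E (\<lambda>W. treatment_sign (W i) * treatment_sign (W k))" for k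
  have "C k = C j" if "k \<noteq> i" for k
  proof -
    have "Transposition.transpose j k permutes UNIV" by (rule permutes_swap_id) auto
    from sum_balanced_permute[OF this, of "\<lambda>W. treatment_sign (W i) * treatment_sign (W j)" p]
    show ?thesis
      using that \<open>i \<noteq> j\<close> by (simp add: C_def expectation_complete_randomization[OF n])
  qed
  then have "(\<Sum>k\<in>UNIV - {i}. C k) = (real CARD('n) - 1) * C j"
    by (simp add: card_Diff_singleton of_nat_diff Suc_leI)
  moreover have "C i = 1" by (simp add: C_def)
  moreover have "(\<Sum>k\<in>UNIV. C k) = 0"
  proof -
    have "(\<Sum>k\<in>UNIV. C k) = ?E (\<lambda>W. \<Sum>k\<in>UNIV. treatment_sign (W i) * treatment_sign (W k))"
      unfolding C_def
      by (rule Bochner_Integration.integral_sum[symmetric]) (rule integrable_measure_pmf_finite, simp)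
    also have "\<dots> = 0"
      by (simp add: expectation_complete_randomization[OF n] sum_distrib_left[symmetric]
          sum_treatment_sign_balanced)
    finally show ?thesis .
  qed
  ultimately have "1 + (real CARD('n) - 1) * C j = 0"
    by (simp add: sum.remove[of UNIV i])
  moreover have "real CARD('n) - 1 \<noteq> 0" using n half_size_pos[OF n] by simp
  ultimately show ?thesis unfolding C_def[symmetric] by (simp add: field_simps)
qed

lemma second_moment_complete_randomization:
  fixes z :: "'n::finite \<Rightarrow> real"
  assumes n: "CARD('n) = 2 * p"
  shows "measure_pmf.expectation (complete_randomization p X Y) (\<lambda>W. (contrast z W)\<^sup>2)
    = (real CARD('n) * (\<Sum>i\<in>UNIV. (z i)\<^sup>2) - (\<Sum>i\<in>UNIV. z i)\<^sup>2) / (real CARD('n) - 1)"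
proof -
  let ?E = "measure_pmf.expectation (complete_randomization p X Y) :: ('n assignment \<Rightarrow> real) \<Rightarrow> real"
  let ?n = "real CARD('n)"
  have n1: "?n - 1 \<noteq> 0" using n half_size_pos[OF n] by simp
  have int: "integrable (measure_pmf (complete_randomization p X Y)) g"
    for g :: "'n assignment \<Rightarrow> real"
    by (rule integrable_measure_pmf_finite) simp
  \<comment> \<open>The covariance matrix of the signs is \<open>(n I - J) / (n - 1)\<close>, with \<open>J\<close> the all-ones matrix.\<close>
  have C: "?E (\<lambda>W. treatment_sign (W i) * treatment_sign (W j))
      = (if j = i then ?n / (?n - 1) else 0) - 1 / (?n - 1)" for i j
    using sign_covariance_complete_randomization[OF n, of i j X Y] n1
    by (auto simp: diff_divide_distrib[symmetric])
  have "?E (\<lambda>W. (contrast z W)\<^sup>2)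
      = ?E (\<lambda>W. \<Sum>i\<in>UNIV. \<Sum>j\<in>UNIV. z i * z j * (treatment_sign (W i) * treatment_sign (W j)))"
    by (simp add: contrast_def power2_eq_square sum_product mult_ac)
  also have "\<dots> = (\<Sum>i\<in>UNIV. \<Sum>j\<in>UNIV. z i * z j * ?E (\<lambda>W. treatment_sign (W i) * treatment_sign (W j)))"
    by (simp add: int)
  also have "\<dots> = (\<Sum>i\<in>UNIV. \<Sum>j\<in>UNIV. (if j = i then z i * z j * (?n / (?n - 1)) else 0)
      - z i * z j / (?n - 1))"
    unfolding C by (intro sum.cong) (auto simp: algebra_simps)
  also have "\<dots> = (\<Sum>i\<in>UNIV. (z i)\<^sup>2 * (?n / (?n - 1))) - (\<Sum>i\<in>UNIV. z i)\<^sup>2 / (?n - 1)"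
    by (simp add: sum_subtractf power2_eq_square sum_product sum_divide_distrib[symmetric])
  also have "\<dots> = (?n * (\<Sum>i\<in>UNIV. (z i)\<^sup>2) - (\<Sum>i\<in>UNIV. z i)\<^sup>2) / (?n - 1)"
    by (simp add: sum_distrib_left sum_divide_distrib diff_divide_distrib mult.commute)
  finally show ?thesis .
qed

text \<open>
  The contrast and the total are the inner products of \<open>z\<close> with two orthogonal vectors of squared
  length \<open>n\<close>, so this is Bessel's inequality. The proof uses the group totals \<open>A 1\<close> and \<open>A 2\<close>, whose
  difference and sum they are, and applies Cauchy--Schwarz in each group of size \<open>p\<close>.
\<close>

lemma contrast_square_le:
  fixes z :: "'n::finite \<Rightarrow> real"
  assumes n: "CARD('n) = 2 * p" and W: "W \<in> balanced p"
  shows "(contrast z W)\<^sup>2 \<le> real CARD('n) * (\<Sum>i\<in>UNIV. (z i)\<^sup>2) - (\<Sum>i\<in>UNIV. z i)\<^sup>2"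
proof -
  define A where "A k = (\<Sum>i | W i = k. z i)" for k
  define Q where "Q k = (\<Sum>i | W i = k. (z i)\<^sup>2)" for k
  have le: "(A k)\<^sup>2 \<le> Q k * p" for k
    using sum_squared_le_sum_of_squares[of z "{i. W i = k}"] W
    by (simp add: A_def Q_def balanced_def)
  have "(contrast z W)\<^sup>2 + (\<Sum>i\<in>UNIV. z i)\<^sup>2 = 2 * (A 1)\<^sup>2 + 2 * (A 2)\<^sup>2"
    unfolding contrast_eq_diff sum_eq_sum_over_groups[of z W] A_def
    by (simp add: power2_eq_square algebra_simps)
  also have "\<dots> \<le> 2 * (Q 1 * p) + 2 * (Q 2 * p)"
    using le[of 1] le[of 2] by linarith
  also have "\<dots> = real CARD('n) * (\<Sum>i\<in>UNIV. (z i)\<^sup>2)"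
    unfolding sum_eq_sum_over_groups[of "\<lambda>i. (z i)\<^sup>2" W] Q_def n by (simp add: algebra_simps)
  finally show ?thesis by simp
qed

lemma contrast_group_assignment_Compl:
  "contrast z (group_assignment (- G)) = - contrast z (group_assignment G)"
  unfolding contrast_def sum_negf[symmetric]
  by (rule sum.cong) (auto simp: group_assignment_def)

lemma expectation_fixed_partition:
  fixes f :: "('n::finite) assignment \<Rightarrow> real"
  assumes "fixed_partition_design X G \<sigma>"
  shows "measure_pmf.expectation (\<sigma> X Y) f
    = (f (group_assignment G) + f (group_assignment (- G))) / 2"
proof -
  let ?a = "group_assignment G" and ?b = "group_assignment (- G)"
  have ne: "?a \<noteq> ?b"
  proof
    assume "?a = ?b"
    then have "?a undefined = ?b undefined" by simp
    then show False by (auto simp: group_assignment_def split: if_splits)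
  qed
  have pmf: "pmf (\<sigma> X Y) ?a = 1 / 2" "pmf (\<sigma> X Y) ?b = 1 / 2"
    using assms by (auto simp: fixed_partition_design_def)
  have "measure_pmf.prob (\<sigma> X Y) {?a, ?b} = 1"
    using ne pmf by (simp add: measure_measure_pmf_finite)
  then have "set_pmf (\<sigma> X Y) \<subseteq> {?a, ?b}"
    by (subst (asm) measure_pmf.prob_eq_1) (auto simp: AE_measure_pmf_iff)
  then have "measure_pmf.expectation (\<sigma> X Y) f = (\<Sum>W\<in>{?a, ?b}. f W * pmf (\<sigma> X Y) W)"
    by (intro integral_measure_pmf_real) auto
  then show ?thesis using ne pmf by simp
qed

lemma var_tau_fixed_partition:
  fixes X :: "'n::finite \<Rightarrow> 'x"
  assumes "p > 0" "fixed_partition_design X G \<sigma>"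
  shows "var_tau p \<sigma> X Y
    = (contrast (outcome_sum Y) (group_assignment G))\<^sup>2 / (4 * (real p)\<^sup>2)"
  using assms
  by (subst var_tau_eq)
    (simp_all add: expectation_fixed_partition contrast_group_assignment_Compl)

text \<open>
  The bound of \<open>contrast_square_le\<close> is \<open>n - 1\<close> times the value computed in
  \<open>second_moment_complete_randomization\<close>, so the ratio of the two variances is at most \<open>n - 1\<close>.
  It is attained by outcomes that are perfectly aligned with the partition.
\<close>

lemma worst_case_fixed_partition:
  fixes X :: "'n::finite \<Rightarrow> 'x"
  assumes n: "CARD('n) = 2 * p" and "V \<ge> 0" and G: "card G = p"
    and \<sigma>: "fixed_partition_design X G \<sigma>"
  shows "(SUP Y\<in>{Y. var_tau p (complete_randomization p) X Y = V}. ennreal (var_tau p \<sigma> X Y))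
    = ennreal (V * (real CARD('n) - 1))"
proof (rule antisym)
  let ?n = "real CARD('n)"
  let ?W = "group_assignment G"
  have p: "p > 0" by (rule half_size_pos[OF n])
  have n1: "?n - 1 > 0" using n p by simp
  have W: "?W \<in> balanced p" by (rule group_assignment_balanced[OF n G])
  have var_CR: "var_tau p (complete_randomization p) X Y
      = (?n * (\<Sum>i\<in>UNIV. (outcome_sum Y i)\<^sup>2) - (\<Sum>i\<in>UNIV. outcome_sum Y i)\<^sup>2)
        / (?n - 1) / (4 * (real p)\<^sup>2)" for Y
    by (simp add: var_tau_design[OF p complete_randomization_in_designs[OF n]]
        second_moment_complete_randomization[OF n])
  show "(SUP Y\<in>{Y. var_tau p (complete_randomization p) X Y = V}. ennreal (var_tau p \<sigma> X Y))
      \<le> ennreal (V * (?n - 1))"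
  proof (rule SUP_least)
    fix Y assume "Y \<in> {Y. var_tau p (complete_randomization p) X Y = V}"
    then have V: "var_tau p (complete_randomization p) X Y = V" by simp
    have "var_tau p \<sigma> X Y
        \<le> (?n * (\<Sum>i\<in>UNIV. (outcome_sum Y i)\<^sup>2) - (\<Sum>i\<in>UNIV. outcome_sum Y i)\<^sup>2) / (4 * (real p)\<^sup>2)"
      unfolding var_tau_fixed_partition[OF p \<sigma>]
      by (intro divide_right_mono contrast_square_le[OF n W]) simp
    also have "\<dots> = V * (?n - 1)"
      using n1 unfolding V[symmetric] var_CR by simp
    finally show "ennreal (var_tau p \<sigma> X Y) \<le> ennreal (V * (?n - 1))" by (rule ennreal_leI)
  qed
  \<comment> \<open>Equality in Bessel's inequality forces \<open>outcome_sum Y\<close> to lie in the span of the constants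
    and the sign vector; \<open>c\<close> scales the sign vector to variance \<open>V\<close> under complete randomization.\<close>
  define c where "c = sqrt (V * (?n - 1))"
  have c2: "c\<^sup>2 = V * (?n - 1)" using n1 \<open>V \<ge> 0\<close> by (simp add: c_def)
  define Y :: "real^2^'n" where
    "Y = (\<chi> i k. if k = 1 then c * treatment_sign (?W i) else 0)"
  have z: "outcome_sum Y = (\<lambda>i. c * treatment_sign (?W i))"
    by (simp add: Y_def outcome_sum_def fun_eq_iff)
  have n2: "?n\<^sup>2 = 4 * (real p)\<^sup>2" by (simp add: n power2_eq_square)
  have sums: "(\<Sum>i\<in>UNIV. outcome_sum Y i) = 0" "(\<Sum>i\<in>UNIV. (outcome_sum Y i)\<^sup>2) = ?n * c\<^sup>2"
    by (simp_all add: z sum_distrib_left[symmetric] sum_treatment_sign_balanced[OF W]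
        power_mult_distrib power2_eq_square[of "treatment_sign _"])
  have "var_tau p (complete_randomization p) X Y = c\<^sup>2 / (?n - 1) * (?n\<^sup>2 / (4 * (real p)\<^sup>2))"
    unfolding var_CR sums by (simp add: power2_eq_square)
  also have "\<dots> = V" using n1 p unfolding n2 c2 by simp
  finally have VY: "var_tau p (complete_randomization p) X Y = V" .
  have "contrast (outcome_sum Y) ?W = ?n * c"
    by (simp add: contrast_def z mult.left_commute[of _ c])
  then have "var_tau p \<sigma> X Y = V * (?n - 1)"
    unfolding var_tau_fixed_partition[OF p \<sigma>] using p
    by (simp only: power_mult_distrib n2 c2) simp
  with VY show "ennreal (V * (?n - 1))
      \<le> (SUP Y\<in>{Y. var_tau p (complete_randomization p) X Y = V}. ennreal (var_tau p \<sigma> X Y))"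
    by (intro SUP_upper2[of Y]) auto
qed

theorem theorem1:
  fixes X :: "'n::finite \<Rightarrow> 'x" and p :: nat and V :: real
  assumes "CARD('n) = 2 * p" and "V > 0"
  shows
    "is_arg_min
       (\<lambda>\<sigma> :: ('x, 'n) design.
          SUP Y\<in>{Y. var_tau p (complete_randomization p) X Y = V}. ennreal (var_tau p \<sigma> X Y))
       (\<lambda>\<sigma>. \<sigma> \<in> designs p X)
       (complete_randomization p)
     \<and>
     (\<forall>N :: real^2^'n \<Rightarrow> real. seminorm N \<longrightarrow> row_permutation_invariant N \<longrightarrow>
        is_arg_min
          (\<lambda>\<sigma> :: ('x, 'n) design. SUP Y\<in>{Y. N Y \<le> V}. ennreal (var_tau p \<sigma> X Y))
          (\<lambda>\<sigma>. \<sigma> \<in> designs p X)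
          (complete_randomization p))
     \<and>
     (\<forall>G (\<sigma> :: ('x, 'n) design). card G = p \<longrightarrow> fixed_partition_design X G \<sigma> \<longrightarrow>
        (SUP Y\<in>{Y. var_tau p (complete_randomization p) X Y = V}. ennreal (var_tau p \<sigma> X Y))
          = ennreal (V * (real CARD('n) - 1)))"
proof (intro conjI allI impI)
  show "is_arg_min
       (\<lambda>\<sigma> :: ('x, 'n) design.
          SUP Y\<in>{Y. var_tau p (complete_randomization p) X Y = V}. ennreal (var_tau p \<sigma> X Y))
       (\<lambda>\<sigma>. \<sigma> \<in> designs p X)
       (complete_randomization p)"
    by (rule complete_randomization_minimax[OF assms(1)])
      (simp add: var_tau_complete_randomization_permute_rows[OF assms(1)])
next
  fix N :: "real^2^'n \<Rightarrow> real"
  assume "row_permutation_invariant N"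
  then show "is_arg_min
          (\<lambda>\<sigma> :: ('x, 'n) design. SUP Y\<in>{Y. N Y \<le> V}. ennreal (var_tau p \<sigma> X Y))
          (\<lambda>\<sigma>. \<sigma> \<in> designs p X)
          (complete_randomization p)"
    by (intro complete_randomization_minimax[OF assms(1)]) (simp add: seminorm_permute_rows)
next
  fix G and \<sigma> :: "('x, 'n) design"
  assume "card G = p" "fixed_partition_design X G \<sigma>"
  with assms show "(SUP Y\<in>{Y. var_tau p (complete_randomization p) X Y = V}. ennreal (var_tau p \<sigma> X Y))
          = ennreal (V * (real CARD('n) - 1))"
    by (intro worst_case_fixed_partition) auto
qed

end
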